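(* Let $(\alpha_1,\alpha_2)$ be a pair of partitions and $r$ a positive integer. Then \[ \tau^r_{\alpha_1,\alpha_2}=w_{\alpha_1,\alpha_2}+\sum_{a}w_{t(a)}, \] where the sum runs over the arrows $a$ of the Remmel–Whitney quiver with source $(\alpha_1,\alpha_2)$ that satisfy the reverse $r$-th row rule.
   Context: Tableaux: English Young diagrams (rows numbered top to bottom, columns left to right); standard tableaux of shape $\alpha/\beta$ are fillings by $1,\dots,|\alpha|-|\beta|$ increasing along rows and columns. $\mathrm{rl}(\alpha/\beta)$ writes $1,\dots,|\alpha/\beta|$ into $\alpha/\beta$ right to left along rows, rows top to bottom. $\mathrm{RW}_{\gamma/\delta}(\alpha/\beta)$: standard tableaux $T$ of shape $\gamma/\delta$ such that if $i,i+1$ share a row of $\mathrm{rl}(\alpha/\beta)$ then $i+1$ is strictly right of and weakly above $i$ in $T$, and if $i$ is directly above $j$ in a column of $\mathrm{rl}(\alpha/\beta)$ then $j$ is strictly below and weakly left of $i$ in $T$. In $\Lambda_1\otimes_{\mathbb Z}\Lambda_2$ (symmetric functions in $x$'s and $y$'s), $s_{\alpha_1,\alpha_2}=s_{\alpha_1}(x)s_{\alpha_2}(y)$. Remmel–Whitney quiver: vertices pairs of partitions, and for distinct pairs with $\alpha_1\subseteq\beta_1$, $\beta_2\subseteq\alpha_2$ one arrow $a_T:(\alpha_1,\alpha_2)\to(\beta_1,\beta_2)$ for each $T\in\mathrm{RW}_{\beta_1/\alpha_1}(\alpha_2/\beta_2)$; $t(a)$ is the target. The Remmel–Whitney basis: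 $w_{\alpha_1,\alpha_2}=s_{\alpha_1,\alpha_2}-\sum_{a}w_{t(a)}$ over all arrows with source $(\alpha_1,\alpha_2)$ (recursive in $|\alpha_2|$). The $r$-th row rule filling of a partition has $r+i-j$ in row $i$, column $j$. For $a_T$ and each $i\in\{1,\dots,|\beta_1|-|\alpha_1|\}$, $R_r(i)$ is the entry of the row rule filling of $\alpha_2$ at the box of $\alpha_2/\beta_2$ labelled $i$ in $\mathrm{rl}(\alpha_2/\beta_2)$, and $\mathrm{row}_T(i)$ the row of $i$ in $T$; $a_T$ satisfies the $r$-th row rule if $R_r(i)\le\mathrm{row}_T(i)$ for all $i$, and the reverse $r$-th row rule if $R_r(i)>\mathrm{row}_T(i)$ for all $i$. The basis $\tau^r_{\alpha_1,\alpha_2}=s_{\alpha_1,\alpha_2}-\sum_a\tau^r_{t(a)}$ (recursively), over arrows with source $(\alpha_1,\alpha_2)$ satisfying the $r$-th row rule. *)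

theory Defs
  imports
    Main
    "HOL-Library.FuncSet"
    "HOL-Library.Poly_Mapping"
    "HOL-Library.Function_Algebras"
begin

section \<open>Partitions and diagrams\<close>

type_synonym box = "nat \<times> nat"  \<comment> \<open>(row, column), both counted from 1\<close>
type_synonym vertex = "nat list \<times> nat list"

definition is_partition :: "nat list \<Rightarrow> bool" where
  "is_partition \<alpha> \<longleftrightarrow> sorted_wrt (\<ge>) \<alpha> \<and> 0 \<notin> set \<alpha>"

definition diagram :: "nat list \<Rightarrow> box set" where
  "diagram \<alpha> = {(i, j). 1 \<le> i \<and> i \<le> length \<alpha> \<and> 1 \<le> j \<and> j \<le> \<alpha> ! (i - 1)}"

definition skew :: "nat list \<Rightarrow> nat list \<Rightarrow> box set" where
  "skew \<alpha> \<beta> = diagram \<alpha> - diagram \<beta>"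


section \<open>Tableaux\<close>

text \<open>
  Fillings of a set of boxes are extensional functions (value \<open>undefined\<close> outside
  the set), so that distinct functions are distinct fillings.
\<close>

definition standard_tableaux :: "nat list \<Rightarrow> nat list \<Rightarrow> (box \<Rightarrow> nat) set" where
  "standard_tableaux \<gamma> \<delta> = {T. T \<in> extensional (skew \<gamma> \<delta>)
     \<and> bij_betw T (skew \<gamma> \<delta>) {1..card (skew \<gamma> \<delta>)}
     \<and> (\<forall>i j j'. (i, j) \<in> skew \<gamma> \<delta> \<longrightarrow> (i, j') \<in> skew \<gamma> \<delta> \<longrightarrow> j < j' \<longrightarrow> T (i, j) < T (i, j'))
     \<and> (\<forall>i i' j. (i, j) \<in> skew \<gamma> \<delta> \<longrightarrow> (i', j) \<in> skew \<gamma> \<delta> \<longrightarrow> i < i' \<longrightarrow> T (i, j) < T (i', j))}"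

definition semistandard_tableaux :: "nat list \<Rightarrow> (box \<Rightarrow> nat) set" where
  "semistandard_tableaux \<alpha> = {T. T \<in> extensional (diagram \<alpha>)
     \<and> (\<forall>i j j'. (i, j) \<in> diagram \<alpha> \<longrightarrow> (i, j') \<in> diagram \<alpha> \<longrightarrow> j < j' \<longrightarrow> T (i, j) \<le> T (i, j'))
     \<and> (\<forall>i i' j. (i, j) \<in> diagram \<alpha> \<longrightarrow> (i', j) \<in> diagram \<alpha> \<longrightarrow> i < i' \<longrightarrow> T (i, j) < T (i', j))}"

text \<open>
  The label of a box of \<open>\<alpha>/\<beta>\<close> is its rank when the boxes are read right to left
  along rows, rows top to bottom.
\<close>

definition rl :: "nat list \<Rightarrow> nat list \<Rightarrow> box \<Rightarrow> nat" where
  "rl \<alpha> \<beta> = (\<lambda>(i, j) \<in> skew \<alpha> \<beta>.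
     card {(i', j'). (i', j') \<in> skew \<alpha> \<beta> \<and> (i' < i \<or> (i' = i \<and> j \<le> j'))})"

text \<open>The box of \<open>\<alpha>/\<beta>\<close> labelled \<open>k\<close> in a bijective filling \<open>T\<close>.\<close>

definition box_of :: "nat list \<Rightarrow> nat list \<Rightarrow> (box \<Rightarrow> nat) \<Rightarrow> nat \<Rightarrow> box" where
  "box_of \<alpha> \<beta> T k = inv_into (skew \<alpha> \<beta>) T k"

abbreviation (input) row :: "box \<Rightarrow> nat" where "row \<equiv> fst"
abbreviation (input) col :: "box \<Rightarrow> nat" where "col \<equiv> snd"

text \<open>
  The conditions compare the positions of one and the same label in \<open>T\<close> and in \<open>rl \<alpha> \<beta>\<close>,
  so both skew shapes must have the same number of boxes.
\<close>

definition RW :: "nat list \<Rightarrow> nat list \<Rightarrow> nat list \<Rightarrow> nat list \<Rightarrow> (box \<Rightarrow> nat) set" where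
  "RW \<gamma> \<delta> \<alpha> \<beta> = {T \<in> standard_tableaux \<gamma> \<delta>.
     card (skew \<gamma> \<delta>) = card (skew \<alpha> \<beta>)
     \<and> (\<forall>i. 1 \<le> i \<and> i + 1 \<le> card (skew \<alpha> \<beta>)
           \<and> row (box_of \<alpha> \<beta> (rl \<alpha> \<beta>) i) = row (box_of \<alpha> \<beta> (rl \<alpha> \<beta>) (i + 1)) \<longrightarrow>
          col (box_of \<gamma> \<delta> T i) < col (box_of \<gamma> \<delta> T (i + 1))
          \<and> row (box_of \<gamma> \<delta> T (i + 1)) \<le> row (box_of \<gamma> \<delta> T i))
     \<and> (\<forall>i\<in>{1..card (skew \<alpha> \<beta>)}. \<forall>j\<in>{1..card (skew \<alpha> \<beta>)}.
          row (box_of \<alpha> \<beta> (rl \<alpha> \<beta>) j) = row (box_of \<alpha> \<beta> (rl \<alpha> \<beta>) i) + 1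
          \<and> col (box_of \<alpha> \<beta> (rl \<alpha> \<beta>) j) = col (box_of \<alpha> \<beta> (rl \<alpha> \<beta>) i) \<longrightarrow>
          row (box_of \<gamma> \<delta> T i) < row (box_of \<gamma> \<delta> T j)
          \<and> col (box_of \<gamma> \<delta> T j) \<le> col (box_of \<gamma> \<delta> T i))}"


section \<open>The Remmel--Whitney quiver\<close>

datatype arrow = Arrow (source: vertex) (target: vertex) (tableau: "box \<Rightarrow> nat")

definition quiver_vertices :: "vertex set" where
  "quiver_vertices = {(\<alpha>1, \<alpha>2). is_partition \<alpha>1 \<and> is_partition \<alpha>2}"

definition quiver_arrows :: "arrow set" where
  "quiver_arrows = {Arrow (\<alpha>1, \<alpha>2) (\<beta>1, \<beta>2) T | \<alpha>1 \<alpha>2 \<beta>1 \<beta>2 T.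
     (\<alpha>1, \<alpha>2) \<in> quiver_vertices \<and> (\<beta>1, \<beta>2) \<in> quiver_vertices \<and> (\<alpha>1, \<alpha>2) \<noteq> (\<beta>1, \<beta>2)
     \<and> diagram \<alpha>1 \<subseteq> diagram \<beta>1 \<and> diagram \<beta>2 \<subseteq> diagram \<alpha>2
     \<and> T \<in> RW \<beta>1 \<alpha>1 \<alpha>2 \<beta>2}"

definition arrows_from :: "vertex \<Rightarrow> arrow set" where
  "arrows_from v = {a \<in> quiver_arrows. source a = v}"

definition row_rule_filling :: "nat \<Rightarrow> box \<Rightarrow> int" where
  "row_rule_filling r b = int r + int (row b) - int (col b)"

text \<open>\<open>arrow_R r a i\<close> is \<open>R\<^sub>r(i)\<close> and \<open>arrow_row a i\<close> is \<open>row\<^sub>T(i)\<close> for \<open>a = a\<^sub>T\<close>.\<close>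

definition arrow_size :: "arrow \<Rightarrow> nat" where
  "arrow_size a = sum_list (fst (target a)) - sum_list (fst (source a))"

definition arrow_R :: "nat \<Rightarrow> arrow \<Rightarrow> nat \<Rightarrow> int" where
  "arrow_R r a i = (let \<alpha>2 = snd (source a); \<beta>2 = snd (target a)
     in row_rule_filling r (box_of \<alpha>2 \<beta>2 (rl \<alpha>2 \<beta>2) i))"

definition arrow_row :: "arrow \<Rightarrow> nat \<Rightarrow> nat" where
  "arrow_row a i = row (box_of (fst (target a)) (fst (source a)) (tableau a) i)"

definition row_rule :: "nat \<Rightarrow> arrow \<Rightarrow> bool" where
  "row_rule r a \<longleftrightarrow> (\<forall>i\<in>{1..arrow_size a}. arrow_R r a i \<le> int (arrow_row a i))"

definition reverse_row_rule :: "nat \<Rightarrow> arrow \<Rightarrow> bool" where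
  "reverse_row_rule r a \<longleftrightarrow> (\<forall>i\<in>{1..arrow_size a}. arrow_R r a i > int (arrow_row a i))"


section \<open>Symmetric functions in two sets of variables\<close>

text \<open>
  A formal power series over the integers in variables \<open>x\<^sub>k\<close> (\<open>k :: nat\<close>) is the function giving
  its coefficients; a monomial is its finitely supported exponent vector.  Series in the \<open>x\<close>'s and
  \<open>y\<close>'s are functions of two exponent vectors, and the tensor product of two rings of symmetric
  functions embeds into them by \<open>f \<otimes> g \<mapsto> f(x) g(y)\<close>.  Addition and subtraction are pointwise.
\<close>

type_synonym monomial = "nat \<Rightarrow>\<^sub>0 nat"
type_synonym series = "monomial \<Rightarrow> int"
type_synonym series2 = "monomial \<times> monomial \<Rightarrow> int"

definition schur :: "nat list \<Rightarrow> series" where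
  "schur \<alpha> m = int (card {T \<in> semistandard_tableaux \<alpha>.
     \<forall>k. Poly_Mapping.lookup m k = card {b \<in> diagram \<alpha>. T b = k}})"

definition tensor :: "series \<Rightarrow> series \<Rightarrow> series2" where
  "tensor f g = (\<lambda>(m, n). f m * g n)"

definition schur2 :: "vertex \<Rightarrow> series2" where
  "schur2 v = tensor (schur (fst v)) (schur (snd v))"


section \<open>Finiteness and termination\<close>

lemma diagram_eq_Sigma:
  "diagram \<alpha> = (SIGMA i:{1..length \<alpha>}. {1..\<alpha> ! (i - 1)})"
  by (auto simp: diagram_def)

lemma finite_diagram [simp]: "finite (diagram \<alpha>)"
  by (simp add: diagram_eq_Sigma)

lemma finite_skew [simp]: "finite (skew \<alpha> \<beta>)"
  by (simp add: skew_def)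

lemma card_diagram: "card (diagram \<alpha>) = sum_list \<alpha>"
proof -
  have "card (diagram \<alpha>) = (\<Sum>i=1..length \<alpha>. \<alpha> ! (i - 1))"
    by (simp add: diagram_eq_Sigma)
  also have "\<dots> = (\<Sum>i<length \<alpha>. \<alpha> ! i)"
    by (rule sum.reindex_bij_witness[of _ Suc "\<lambda>i. i - 1"]) auto
  finally show ?thesis by (simp add: sum_list_sum_nth atLeast0LessThan)
qed

lemma card_skew:
  "diagram \<beta> \<subseteq> diagram \<alpha> \<Longrightarrow> card (skew \<alpha> \<beta>) = sum_list \<alpha> - sum_list \<beta>"
  by (simp add: skew_def card_Diff_subset card_diagram)

lemma in_diagram_Suc_iff:
  "(Suc i, Suc j) \<in> diagram \<alpha> \<longleftrightarrow> i < length \<alpha> \<and> j < \<alpha> ! i"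
  by (auto simp: diagram_def)

lemma partition_nth_pos: "is_partition \<alpha> \<Longrightarrow> i < length \<alpha> \<Longrightarrow> 0 < \<alpha> ! i"
  by (metis is_partition_def nth_mem neq0_conv)

lemma diagram_subset_imp_nth:
  assumes "is_partition \<alpha>" "diagram \<alpha> \<subseteq> diagram \<beta>" "i < length \<alpha>"
  shows "i < length \<beta> \<and> \<alpha> ! i \<le> \<beta> ! i"
proof -
  have "(Suc i, Suc (\<alpha> ! i - 1)) \<in> diagram \<alpha>"
    unfolding in_diagram_Suc_iff using assms partition_nth_pos[of \<alpha> i] by simp
  then have "(Suc i, Suc (\<alpha> ! i - 1)) \<in> diagram \<beta>" using assms by blast
  then show ?thesis unfolding in_diagram_Suc_iff by linarith
qed

lemma diagram_inj:
  assumes "is_partition \<alpha>" "is_partition \<beta>" "diagram \<alpha> = diagram \<beta>"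
  shows "\<alpha> = \<beta>"
proof (rule nth_equalityI)
  show "length \<alpha> = length \<beta>"
    using diagram_subset_imp_nth[of \<alpha> \<beta>] diagram_subset_imp_nth[of \<beta> \<alpha>] assms
    by (metis linorder_neqE_nat less_irrefl order_refl)
next
  fix i assume "i < length \<alpha>"
  then show "\<alpha> ! i = \<beta> ! i"
    using diagram_subset_imp_nth[of \<alpha> \<beta> i] diagram_subset_imp_nth[of \<beta> \<alpha> i] assms
    by (simp add: antisym)
qed

lemma arrows_from_E:
  assumes "a \<in> arrows_from v"
  obtains \<alpha>1 \<alpha>2 \<beta>1 \<beta>2 T where
    "v = (\<alpha>1, \<alpha>2)" "a = Arrow (\<alpha>1, \<alpha>2) (\<beta>1, \<beta>2) T"
    "is_partition \<alpha>1" "is_partition \<alpha>2" "is_partition \<beta>1" "is_partition \<beta>2"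
    "(\<alpha>1, \<alpha>2) \<noteq> (\<beta>1, \<beta>2)"
    "diagram \<alpha>1 \<subseteq> diagram \<beta>1" "diagram \<beta>2 \<subseteq> diagram \<alpha>2" "T \<in> RW \<beta>1 \<alpha>1 \<alpha>2 \<beta>2"
  using assms by (auto simp: arrows_from_def quiver_arrows_def quiver_vertices_def)

lemma card_skew_RW: "T \<in> RW \<gamma> \<delta> \<alpha> \<beta> \<Longrightarrow> card (skew \<gamma> \<delta>) = card (skew \<alpha> \<beta>)"
  by (simp add: RW_def)

lemma arrows_from_decreases:
  assumes "a \<in> arrows_from v"
  shows "sum_list (snd (target a)) < sum_list (snd v)"
  using assms
proof (rule arrows_from_E)
  fix \<alpha>1 \<alpha>2 \<beta>1 \<beta>2 T
  assume v: "v = (\<alpha>1, \<alpha>2)" and a: "a = Arrow (\<alpha>1, \<alpha>2) (\<beta>1, \<beta>2) T"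
    and p: "is_partition \<alpha>1" "is_partition \<alpha>2" "is_partition \<beta>1" "is_partition \<beta>2"
    and ne: "(\<alpha>1, \<alpha>2) \<noteq> (\<beta>1, \<beta>2)"
    and sub: "diagram \<alpha>1 \<subseteq> diagram \<beta>1" "diagram \<beta>2 \<subseteq> diagram \<alpha>2"
    and T: "T \<in> RW \<beta>1 \<alpha>1 \<alpha>2 \<beta>2"
  have "diagram \<beta>2 \<noteq> diagram \<alpha>2"
  proof
    assume eq: "diagram \<beta>2 = diagram \<alpha>2"
    then have "card (skew \<beta>1 \<alpha>1) = 0" using card_skew_RW[OF T] by (simp add: skew_def)
    then have "diagram \<beta>1 = diagram \<alpha>1" using sub by (auto simp: skew_def)
    with eq p ne show False by (auto dest: diagram_inj)
  qed
  then have "card (diagram \<beta>2) < card (diagram \<alpha>2)"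
    using sub by (intro psubset_card_mono) auto
  then show ?thesis by (simp add: v a card_diagram)
qed

lemma finite_partitions_le: "finite {\<alpha>. is_partition \<alpha> \<and> sum_list \<alpha> \<le> n}"
proof (rule finite_subset)
  show "finite {\<alpha>. set \<alpha> \<subseteq> {..n} \<and> length \<alpha> \<le> n}"
    by (rule finite_lists_length_le) simp
  have "length \<alpha> \<le> sum_list \<alpha>" if "0 \<notin> set \<alpha>" for \<alpha> :: "nat list"
    using that by (induction \<alpha>) auto
  then show "{\<alpha>. is_partition \<alpha> \<and> sum_list \<alpha> \<le> n} \<subseteq> {\<alpha>. set \<alpha> \<subseteq> {..n} \<and> length \<alpha> \<le> n}"
    by (auto simp: is_partition_def intro: order_trans[OF member_le_sum_list] order_trans)
qed

lemma finite_standard_tableaux: "finite (standard_tableaux \<gamma> \<delta>)"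
proof (rule finite_subset)
  show "standard_tableaux \<gamma> \<delta> \<subseteq> skew \<gamma> \<delta> \<rightarrow>\<^sub>E {1..card (skew \<gamma> \<delta>)}"
    by (auto simp: standard_tableaux_def PiE_def Pi_def bij_betw_def simp del: atLeastAtMost_iff)
  show "finite (skew \<gamma> \<delta> \<rightarrow>\<^sub>E {1..card (skew \<gamma> \<delta>)})"
    by (rule finite_PiE) auto
qed

lemma finite_arrows_from: "finite (arrows_from v)"
proof -
  define n where "n = sum_list (fst v) + sum_list (snd v)"
  define P where "P = {\<alpha>. is_partition \<alpha> \<and> sum_list \<alpha> \<le> n}"
  have "arrows_from v \<subseteq> (\<Union>\<beta>1\<in>P. \<Union>\<beta>2\<in>P. Arrow v (\<beta>1, \<beta>2) ` standard_tableaux \<beta>1 (fst v))"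
  proof
    fix a assume "a \<in> arrows_from v"
    then show "a \<in> (\<Union>\<beta>1\<in>P. \<Union>\<beta>2\<in>P. Arrow v (\<beta>1, \<beta>2) ` standard_tableaux \<beta>1 (fst v))"
    proof (rule arrows_from_E)
      fix \<alpha>1 \<alpha>2 \<beta>1 \<beta>2 T
      assume v: "v = (\<alpha>1, \<alpha>2)" and a: "a = Arrow (\<alpha>1, \<alpha>2) (\<beta>1, \<beta>2) T"
        and p: "is_partition \<beta>1" "is_partition \<beta>2"
        and sub: "diagram \<alpha>1 \<subseteq> diagram \<beta>1" "diagram \<beta>2 \<subseteq> diagram \<alpha>2"
        and T: "T \<in> RW \<beta>1 \<alpha>1 \<alpha>2 \<beta>2"
      have "sum_list \<beta>2 \<le> sum_list \<alpha>2"
        using card_mono[OF _ sub(2)] by (simp add: card_diagram)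
      moreover have "sum_list \<beta>1 \<le> n"
        using card_skew_RW[OF T] sub by (simp add: card_skew n_def v)
      ultimately have "\<beta>1 \<in> P" "\<beta>2 \<in> P" using p by (simp_all add: P_def n_def v)
      moreover have "T \<in> standard_tableaux \<beta>1 (fst v)" using T by (simp add: RW_def v)
      ultimately show ?thesis by (auto simp: a v)
    qed
  qed
  moreover have "finite P" unfolding P_def by (rule finite_partitions_le)
  ultimately show ?thesis
    by (elim finite_subset) (intro finite_UN_I finite_imageI finite_standard_tableaux)
qed


section \<open>The two bases\<close>

function w_basis :: "vertex \<Rightarrow> series2" where
  "w_basis v = schur2 v - (\<Sum>a\<in>arrows_from v. w_basis (target a))"
  by auto
termination
  by (relation "measure (\<lambda>v. sum_list (snd v))") (auto intro: arrows_from_decreases)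

function tau_basis :: "nat \<Rightarrow> vertex \<Rightarrow> series2" where
  "tau_basis r v = schur2 v - (\<Sum>a\<in>{a \<in> arrows_from v. row_rule r a}. tau_basis r (target a))"
  by auto
termination
  by (relation "measure (\<lambda>(r, v). sum_list (snd v))") (auto intro: arrows_from_decreases)

declare w_basis.simps [simp del] tau_basis.simps [simp del]

end

(* Composing the inverse of a tableau T in RW(gamma/delta, alpha/beta) with the reading filling
   of alpha/beta turns T into a "picture", a bijection f from alpha/beta to gamma/delta. Call a box b
   upper if R_r(b) <= row (f b). Moving left along a row or up along a column, the local picture
   conditions show that boxes which are not upper stay not upper; dually the images of the upper
   boxes form an order ideal on top of delta. Hence f splits, in exactly one way, into a picture on
   the upper boxes (an arrow with the row rule) followed by a picture on the remaining boxes (an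
   arrow with the reverse row rule), and conversely any two such pictures glue. With 1 + A, 1 + B,
   1 + C the arrow counting matrices (including identities) for all arrows, row rule and reverse
   row rule, this says 1 + A = (1 + B)(1 + C); as s = (1 + A) w = (1 + B) tau, it follows that
   tau = (1 + C) w. *)

theory Submission
  imports Defs
begin

section \<open>Reading order of boxes and the labels of \<open>rl\<close>\<close>

text \<open>This is the strict order whose ranks are the labels \<open>rl\<close>; it lets later
  arguments compare boxes directly instead of counting.\<close>

definition reads_before :: "box \<Rightarrow> box \<Rightarrow> bool" where
  "reads_before b c \<longleftrightarrow> fst b < fst c \<or> fst b = fst c \<and> snd c < snd b"

lemma rl_eq_card:
  assumes "b \<in> skew \<alpha> \<beta>"
  shows "rl \<alpha> \<beta> b = card {c \<in> skew \<alpha> \<beta>. c = b \<or> reads_before c b}"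
proof -
  obtain i j where b: "b = (i, j)" by (cases b)
  have "{(i', j'). (i', j') \<in> skew \<alpha> \<beta> \<and> (i' < i \<or> (i' = i \<and> j \<le> j'))} =
      {c \<in> skew \<alpha> \<beta>. c = b \<or> reads_before c b}"
    by (auto simp: reads_before_def b)
  with assms show ?thesis by (simp add: rl_def b)
qed

lemma rl_strict_mono:
  assumes "b \<in> skew \<alpha> \<beta>" "c \<in> skew \<alpha> \<beta>" "reads_before b c"
  shows "rl \<alpha> \<beta> b < rl \<alpha> \<beta> c"
proof -
  have "{d \<in> skew \<alpha> \<beta>. d = b \<or> reads_before d b} \<subset> {d \<in> skew \<alpha> \<beta>. d = c \<or> reads_before d c}"
    (is "?L \<subset> ?R")
  proof
    show "?L \<subseteq> ?R" using assms(3) by (auto simp: reads_before_def)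
    have "c \<in> ?R" "c \<notin> ?L" using assms by (auto simp: reads_before_def)
    then show "?L \<noteq> ?R" by blast
  qed
  then show ?thesis
    unfolding rl_eq_card[OF assms(1)] rl_eq_card[OF assms(2)]
    by (intro psubset_card_mono) auto
qed

lemma reads_before_linear: "b = c \<or> reads_before b c \<or> reads_before c b"
  by (auto simp: reads_before_def prod_eq_iff)

lemma rl_less_iff:
  assumes "b \<in> skew \<alpha> \<beta>" "c \<in> skew \<alpha> \<beta>"
  shows "rl \<alpha> \<beta> b < rl \<alpha> \<beta> c \<longleftrightarrow> reads_before b c"
  using rl_strict_mono[OF assms] rl_strict_mono[OF assms(2,1)] reads_before_linear[of b c]
  by (metis less_asym less_irrefl)

text \<open>Ranks in a finite strict total order are distinct and lie between 1 and the number of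
  elements, so counting gives surjectivity.\<close>

lemma bij_rl: "bij_betw (rl \<alpha> \<beta>) (skew \<alpha> \<beta>) {1..card (skew \<alpha> \<beta>)}"
proof -
  have inj: "inj_on (rl \<alpha> \<beta>) (skew \<alpha> \<beta>)"
    by (rule inj_onI) (metis less_irrefl reads_before_linear rl_strict_mono)
  have "rl \<alpha> \<beta> b \<in> {1..card (skew \<alpha> \<beta>)}" if "b \<in> skew \<alpha> \<beta>" for b
  proof -
    let ?S = "{c \<in> skew \<alpha> \<beta>. c = b \<or> reads_before c b}"
    have "b \<in> ?S" and "finite ?S" and "?S \<subseteq> skew \<alpha> \<beta>" using that by auto
    then have "card ?S > 0" and "card ?S \<le> card (skew \<alpha> \<beta>)"
      by (metis card_gt_0_iff empty_iff) (intro card_mono finite_skew, fact)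
    then show ?thesis unfolding rl_eq_card[OF that] by simp
  qed
  then have "rl \<alpha> \<beta> ` skew \<alpha> \<beta> = {1..card (skew \<alpha> \<beta>)}"
    by (intro card_subset_eq) (auto simp: card_image[OF inj])
  with inj show ?thesis by (simp add: bij_betw_def)
qed

text \<open>Nothing is read between a box and its left neighbour, so the initial segment ending at
  the latter gains just one box.\<close>

lemma rl_left_neighbour:
  assumes "(i, j) \<in> skew \<alpha> \<beta>" "(i, Suc j) \<in> skew \<alpha> \<beta>"
  shows "rl \<alpha> \<beta> (i, j) = Suc (rl \<alpha> \<beta> (i, Suc j))"
proof -
  have "{c \<in> skew \<alpha> \<beta>. c = (i, j) \<or> reads_before c (i, j)} =
      insert (i, j) {c \<in> skew \<alpha> \<beta>. c = (i, Suc j) \<or> reads_before c (i, Suc j)}"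
    using assms by (auto simp: reads_before_def)
  then show ?thesis
    unfolding rl_eq_card[OF assms(1)] rl_eq_card[OF assms(2)]
    by (simp add: reads_before_def)
qed

lemma skew_row_convex:
  assumes "(i, j) \<in> skew \<alpha> \<beta>" "(i, k) \<in> skew \<alpha> \<beta>" "j \<le> m" "m \<le> k"
  shows "(i, m) \<in> skew \<alpha> \<beta>"
  using assms by (simp add: skew_def diagram_def) linarith

text \<open>Otherwise row convexity would put the box just right of \<open>c\<close> into the shape
  strictly between \<open>c\<close> and \<open>b\<close>, and its label would fall strictly between
  two consecutive ones.\<close>

lemma rl_consecutive_in_row:
  assumes "b \<in> skew \<alpha> \<beta>" "c \<in> skew \<alpha> \<beta>" "fst b = fst c" "rl \<alpha> \<beta> c = Suc (rl \<alpha> \<beta> b)"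
  shows "snd b = Suc (snd c)"
proof (rule ccontr)
  assume ne: "snd b \<noteq> Suc (snd c)"
  have "reads_before b c" using rl_less_iff[OF assms(1,2)] assms(4) by simp
  then have lt: "Suc (snd c) < snd b" using ne assms(3) by (auto simp: reads_before_def)
  define d where "d = (fst b, Suc (snd c))"
  have "(fst b, snd c) \<in> skew \<alpha> \<beta>" "(fst b, snd b) \<in> skew \<alpha> \<beta>"
    using assms(1,2) by (metis assms(3) prod.collapse)+
  then have d: "d \<in> skew \<alpha> \<beta>" unfolding d_def
    by (rule skew_row_convex) (use lt in auto)
  have "reads_before b d" "reads_before d c" using lt assms(3) by (auto simp: d_def reads_before_def)
  then have "rl \<alpha> \<beta> b < rl \<alpha> \<beta> d" "rl \<alpha> \<beta> d < rl \<alpha> \<beta> c"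
    using rl_strict_mono[OF assms(1) d] rl_strict_mono[OF d assms(2)] by simp_all
  then show False using assms(4) by simp
qed

section \<open>Pictures and their correspondence with \<open>RW\<close>\<close>

text \<open>These are the row and column conditions of \<open>RW\<close>, carried over to the map
  \<open>f\<close> that applies \<open>rl\<close> and then the inverse of \<open>T\<close>. Within a
  row the left neighbour has the larger label, which is why its image lies further right.\<close>

definition picture_local :: "box set \<Rightarrow> (box \<Rightarrow> box) \<Rightarrow> bool" where
  "picture_local A f \<longleftrightarrow>
     (\<forall>i j. (i, j) \<in> A \<longrightarrow> (i, Suc j) \<in> A \<longrightarrow>
        snd (f (i, Suc j)) < snd (f (i, j)) \<and> fst (f (i, j)) \<le> fst (f (i, Suc j)))
   \<and> (\<forall>i j. (i, j) \<in> A \<longrightarrow> (Suc i, j) \<in> A \<longrightarrow>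
        fst (f (i, j)) < fst (f (Suc i, j)) \<and> snd (f (Suc i, j)) \<le> snd (f (i, j)))"

text \<open>Standardness of \<open>T\<close>, carried over in the same way: \<open>T\<close>
  increases along rows and columns exactly when the preimages under \<open>f\<close> are met in
  reading order.\<close>

definition picture_order :: "box set \<Rightarrow> (box \<Rightarrow> box) \<Rightarrow> bool" where
  "picture_order A f \<longleftrightarrow> (\<forall>b\<in>A. \<forall>c\<in>A.
     (fst (f b) = fst (f c) \<and> snd (f b) < snd (f c) \<or>
      snd (f b) = snd (f c) \<and> fst (f b) < fst (f c)) \<longrightarrow> reads_before b c)"

lemma picture_orderD:
  assumes "picture_order A f" "b \<in> A" "c \<in> A"
    and "fst (f b) = fst (f c) \<and> snd (f b) < snd (f c) \<or>
      snd (f b) = snd (f c) \<and> fst (f b) < fst (f c)"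
  shows "reads_before b c"
  using assms unfolding picture_order_def by blast

definition picture :: "box set \<Rightarrow> box set \<Rightarrow> (box \<Rightarrow> box) \<Rightarrow> bool" where
  "picture A B f \<longleftrightarrow> f \<in> extensional A \<and> bij_betw f A B \<and> picture_local A f \<and> picture_order A f"

text \<open>By \<open>Tf\<close>, the box of \<open>T\<close> with label
  \<open>rl \<alpha> \<beta> b\<close> is \<open>f b\<close>, so each condition of \<open>RW\<close>
  turns into one condition of \<open>picture\<close>.\<close>

lemma RW_iff_picture:
  assumes f: "f \<in> extensional (skew \<alpha> \<beta>)" "bij_betw f (skew \<alpha> \<beta>) (skew \<gamma> \<delta>)"
    and T: "T \<in> extensional (skew \<gamma> \<delta>)" "bij_betw T (skew \<gamma> \<delta>) {1..card (skew \<alpha> \<beta>)}"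
    and Tf: "\<And>b. b \<in> skew \<alpha> \<beta> \<Longrightarrow> T (f b) = rl \<alpha> \<beta> b"
  shows "T \<in> RW \<gamma> \<delta> \<alpha> \<beta> \<longleftrightarrow> picture (skew \<alpha> \<beta>) (skew \<gamma> \<delta>) f"
proof -
  let ?A = "skew \<alpha> \<beta>" and ?B = "skew \<gamma> \<delta>"
  have card: "card ?B = card ?A" using bij_betw_same_card[OF f(2)] by simp
  have B: "?B = f ` ?A" using f(2) by (simp add: bij_betw_def)
  have N: "{1..card ?A} = rl \<alpha> \<beta> ` ?A" using bij_rl by (metis bij_betw_def)
  have box_T: "box_of \<gamma> \<delta> T (rl \<alpha> \<beta> b) = f b" if "b \<in> ?A" for b
    unfolding box_of_def Tf[OF that, symmetric]
    using that T(2) B by (intro inv_into_f_f) (auto simp: bij_betw_def)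
  have box_rl: "box_of \<alpha> \<beta> (rl \<alpha> \<beta>) (rl \<alpha> \<beta> b) = b" if "b \<in> ?A" for b
    unfolding box_of_def using that bij_rl[of \<alpha> \<beta>] by (auto simp: bij_betw_def)
  have std: "T \<in> standard_tableaux \<gamma> \<delta> \<longleftrightarrow> picture_order ?A f" (is "?L \<longleftrightarrow> ?R")
  proof
    assume L: ?L
    show ?R unfolding picture_order_def
    proof (intro ballI impI)
      fix b c assume bc: "b \<in> ?A" "c \<in> ?A"
        and "fst (f b) = fst (f c) \<and> snd (f b) < snd (f c) \<or>
          snd (f b) = snd (f c) \<and> fst (f b) < fst (f c)"
      moreover have "(fst (f b), snd (f b)) \<in> ?B" "(fst (f c), snd (f c)) \<in> ?B"
        using bc B by auto
      ultimately have "T (fst (f b), snd (f b)) < T (fst (f c), snd (f c))"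
        using L unfolding standard_tableaux_def mem_Collect_eq by metis
      then show "reads_before b c" using bc by (simp add: Tf rl_less_iff)
    qed
  next
    assume R: ?R
    have lt: "T x < T y" if "x \<in> ?B" "y \<in> ?B"
      "fst x = fst y \<and> snd x < snd y \<or> snd x = snd y \<and> fst x < fst y" for x y
    proof -
      obtain b c where "b \<in> ?A" "c \<in> ?A" "x = f b" "y = f c" using \<open>x \<in> ?B\<close> \<open>y \<in> ?B\<close> B by blast
      then show ?thesis using R that by (auto simp: Tf rl_less_iff picture_order_def)
    qed
    show ?L unfolding standard_tableaux_def using T card by (auto intro!: lt)
  qed
  \<comment> \<open>Consecutive labels within one row sit on adjacent boxes, the smaller label on
    the right.\<close>
  have row: "(\<forall>i. 1 \<le> i \<and> i + 1 \<le> card ?A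
           \<and> fst (box_of \<alpha> \<beta> (rl \<alpha> \<beta>) i) = fst (box_of \<alpha> \<beta> (rl \<alpha> \<beta>) (i + 1)) \<longrightarrow>
          snd (box_of \<gamma> \<delta> T i) < snd (box_of \<gamma> \<delta> T (i + 1))
          \<and> fst (box_of \<gamma> \<delta> T (i + 1)) \<le> fst (box_of \<gamma> \<delta> T i)) \<longleftrightarrow>
      (\<forall>i j. (i, j) \<in> ?A \<longrightarrow> (i, Suc j) \<in> ?A \<longrightarrow>
        snd (f (i, Suc j)) < snd (f (i, j)) \<and> fst (f (i, j)) \<le> fst (f (i, Suc j)))" (is "?L \<longleftrightarrow> ?R")
  proof
    assume L: ?L
    show ?R
    proof (intro allI impI)
      fix i j assume ij: "(i, j) \<in> ?A" "(i, Suc j) \<in> ?A"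
      let ?k = "rl \<alpha> \<beta> (i, Suc j)"
      have eq: "?k + 1 = rl \<alpha> \<beta> (i, j)" using rl_left_neighbour[OF ij] by simp
      have "?k \<in> {1..card ?A}" "?k + 1 \<in> {1..card ?A}" unfolding eq N using ij by blast+
      then show "snd (f (i, Suc j)) < snd (f (i, j)) \<and> fst (f (i, j)) \<le> fst (f (i, Suc j))"
        using L[rule_format, of ?k] unfolding eq by (simp add: ij box_rl box_T)
    qed
  next
    assume R: ?R
    show ?L
    proof (intro allI impI, elim conjE)
      fix k assume k: "1 \<le> k" "k + 1 \<le> card ?A"
        and same: "fst (box_of \<alpha> \<beta> (rl \<alpha> \<beta>) k) = fst (box_of \<alpha> \<beta> (rl \<alpha> \<beta>) (k + 1))"
      have "k \<in> rl \<alpha> \<beta> ` ?A" "k + 1 \<in> rl \<alpha> \<beta> ` ?A" unfolding N[symmetric] using k by auto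
      then obtain b c where bc: "b \<in> ?A" "k = rl \<alpha> \<beta> b" "c \<in> ?A" "k + 1 = rl \<alpha> \<beta> c" by blast
      have "fst b = fst c" using same unfolding bc(4) unfolding bc(2) by (simp add: bc(1,3) box_rl)
      moreover from this have "snd b = Suc (snd c)"
        using rl_consecutive_in_row[OF bc(1,3)] bc by simp
      ultimately show "snd (box_of \<gamma> \<delta> T k) < snd (box_of \<gamma> \<delta> T (k + 1))
          \<and> fst (box_of \<gamma> \<delta> T (k + 1)) \<le> fst (box_of \<gamma> \<delta> T k)"
        using R[rule_format, of "fst c" "snd c"] bc(1,3)
        unfolding bc(4) unfolding bc(2) by (cases b, cases c) (simp add: box_T)
    qed
  qed
  have col: "(\<forall>i\<in>{1..card ?A}. \<forall>j\<in>{1..card ?A}.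
          fst (box_of \<alpha> \<beta> (rl \<alpha> \<beta>) j) = fst (box_of \<alpha> \<beta> (rl \<alpha> \<beta>) i) + 1
          \<and> snd (box_of \<alpha> \<beta> (rl \<alpha> \<beta>) j) = snd (box_of \<alpha> \<beta> (rl \<alpha> \<beta>) i) \<longrightarrow>
          fst (box_of \<gamma> \<delta> T i) < fst (box_of \<gamma> \<delta> T j)
          \<and> snd (box_of \<gamma> \<delta> T j) \<le> snd (box_of \<gamma> \<delta> T i)) \<longleftrightarrow>
     (\<forall>i j. (i, j) \<in> ?A \<longrightarrow> (Suc i, j) \<in> ?A \<longrightarrow>
        fst (f (i, j)) < fst (f (Suc i, j)) \<and> snd (f (Suc i, j)) \<le> snd (f (i, j)))"
    (is "?L \<longleftrightarrow> ?R")
  proof -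
    have "?L \<longleftrightarrow> (\<forall>b\<in>?A. \<forall>c\<in>?A. fst c = fst b + 1 \<and> snd c = snd b \<longrightarrow>
        fst (f b) < fst (f c) \<and> snd (f c) \<le> snd (f b))"
      unfolding N by (simp only: ball_simps) (intro ball_cong refl, simp only: box_T box_rl)
    also have "\<dots> \<longleftrightarrow> ?R" by auto
    finally show ?thesis .
  qed
  show ?thesis
    unfolding RW_def picture_def picture_local_def mem_Collect_eq card std row col
    using f by (simp only: simp_thms conj_ac)
qed

definition RW_to_picture ::
    "nat list \<Rightarrow> nat list \<Rightarrow> nat list \<Rightarrow> nat list \<Rightarrow> (box \<Rightarrow> nat) \<Rightarrow> box \<Rightarrow> box" where
  "RW_to_picture \<gamma> \<delta> \<alpha> \<beta> T = (\<lambda>b\<in>skew \<alpha> \<beta>. box_of \<gamma> \<delta> T (rl \<alpha> \<beta> b))"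

definition picture_to_RW ::
    "nat list \<Rightarrow> nat list \<Rightarrow> nat list \<Rightarrow> nat list \<Rightarrow> (box \<Rightarrow> box) \<Rightarrow> box \<Rightarrow> nat" where
  "picture_to_RW \<gamma> \<delta> \<alpha> \<beta> f = (\<lambda>c\<in>skew \<gamma> \<delta>. rl \<alpha> \<beta> (inv_into (skew \<alpha> \<beta>) f c))"

text \<open>The inverse of \<open>T\<close> after \<open>rl\<close>, and \<open>rl\<close> after the
  inverse of \<open>f\<close>, are mutually inverse constructions, and \<open>RW_iff_picture\<close>
  applies to both.\<close>

lemma bij_betw_RW_pictures:
  "bij_betw (RW_to_picture \<gamma> \<delta> \<alpha> \<beta>) (RW \<gamma> \<delta> \<alpha> \<beta>) {f. picture (skew \<alpha> \<beta>) (skew \<gamma> \<delta>) f}"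
proof -
  let ?A = "skew \<alpha> \<beta>" and ?B = "skew \<gamma> \<delta>"
  let ?F = "RW_to_picture \<gamma> \<delta> \<alpha> \<beta>" and ?G = "picture_to_RW \<gamma> \<delta> \<alpha> \<beta>"
  have rl_img: "rl \<alpha> \<beta> ` ?A = {1..card ?A}" using bij_rl by (metis bij_betw_def)
  have 1: "picture ?A ?B (?F T) \<and> ?G (?F T) = T" if T: "T \<in> RW \<gamma> \<delta> \<alpha> \<beta>" for T
  proof -
    have ext: "T \<in> extensional ?B" and bij: "bij_betw T ?B {1..card ?A}"
      using T by (auto simp: RW_def standard_tableaux_def)
    have "bij_betw (inv_into ?B T \<circ> rl \<alpha> \<beta>) ?A ?B"
      by (rule bij_betw_trans[OF bij_rl bij_betw_inv_into[OF bij]])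
    then have bijF: "bij_betw (?F T) ?A ?B"
      by (rule bij_betw_cong[THEN iffD1, rotated]) (simp add: RW_to_picture_def box_of_def)
    have TF: "T (?F T b) = rl \<alpha> \<beta> b" if "b \<in> ?A" for b
    proof -
      have "rl \<alpha> \<beta> b \<in> {1..card ?A}" using that rl_img by blast
      then show ?thesis
        using that bij_betw_inv_into_right[OF bij] by (simp add: RW_to_picture_def box_of_def)
    qed
    have extF: "?F T \<in> extensional ?A" by (simp add: RW_to_picture_def)
    have "?G (?F T) = T"
    proof (rule extensionalityI)
      fix c assume c: "c \<in> ?B"
      define b where "b = inv_into ?A (?F T) c"
      have "b \<in> ?A" "?F T b = c"
        using c bijF unfolding b_def by (auto simp: bij_betw_def inv_into_into f_inv_into_f)
      then show "?G (?F T) c = T c" using TF[of b] c by (simp add: picture_to_RW_def b_def[symmetric])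
    qed (use ext in \<open>auto simp: picture_to_RW_def\<close>)
    then show ?thesis using RW_iff_picture[OF extF bijF ext bij TF] T by blast
  qed
  have 2: "?G f \<in> RW \<gamma> \<delta> \<alpha> \<beta> \<and> ?F (?G f) = f" if f: "picture ?A ?B f" for f
  proof -
    have ext: "f \<in> extensional ?A" and bij: "bij_betw f ?A ?B"
      using f by (auto simp: picture_def)
    have "bij_betw (rl \<alpha> \<beta> \<circ> inv_into ?A f) ?B {1..card ?A}"
      by (rule bij_betw_trans[OF bij_betw_inv_into[OF bij] bij_rl])
    then have bijG: "bij_betw (?G f) ?B {1..card ?A}"
      by (rule bij_betw_cong[THEN iffD1, rotated]) (simp add: picture_to_RW_def)
    have fB: "f b \<in> ?B" if "b \<in> ?A" for b using that bij by (auto simp: bij_betw_def)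
    have GF: "?G f (f b) = rl \<alpha> \<beta> b" if "b \<in> ?A" for b
      using that fB bij_betw_inv_into_left[OF bij] by (simp add: picture_to_RW_def)
    have extG: "?G f \<in> extensional ?B" by (simp add: picture_to_RW_def)
    have "?F (?G f) = f"
    proof (rule extensionalityI)
      fix b assume b: "b \<in> ?A"
      show "?F (?G f) b = f b"
        using b bij_betw_inv_into_left[OF bijG fB[OF b]]
        by (simp add: RW_to_picture_def box_of_def GF)
    qed (use ext in \<open>auto simp: RW_to_picture_def\<close>)
    then show ?thesis using RW_iff_picture[OF ext bij extG bijG GF] f by blast
  qed
  show ?thesis by (rule bij_betw_byWitness[where f' = ?G]) (use 1 2 in auto)
qed

lemma picture_RW_to_picture:
  "T \<in> RW \<gamma> \<delta> \<alpha> \<beta> \<Longrightarrow> picture (skew \<alpha> \<beta>) (skew \<gamma> \<delta>) (RW_to_picture \<gamma> \<delta> \<alpha> \<beta> T)"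
  using bij_betwE[OF bij_betw_RW_pictures] by blast

section \<open>Arrows, with identities added, as sets of pictures\<close>

text \<open>
  Targets equal to \<open>v\<close> are allowed: they contribute exactly the empty picture, so these sets
  encode the arrows obeying \<open>K\<close> together with an identity arrow.
\<close>

definition pictures_from :: "(box \<Rightarrow> box \<Rightarrow> bool) \<Rightarrow> vertex \<Rightarrow> (vertex \<times> (box \<Rightarrow> box)) set" where
  "pictures_from K v = {(u, f). u \<in> quiver_vertices
     \<and> diagram (fst v) \<subseteq> diagram (fst u) \<and> diagram (snd u) \<subseteq> diagram (snd v)
     \<and> picture (skew (snd v) (snd u)) (skew (fst u) (fst v)) f
     \<and> (\<forall>b\<in>skew (snd v) (snd u). K b (f b))}"

text \<open>The parameter \<open>K\<close> can be the row rule, its negation box by box, or no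
  condition, so the passage from arrows to pictures is proved once for all three.\<close>

definition arrow_obeys :: "(box \<Rightarrow> box \<Rightarrow> bool) \<Rightarrow> arrow \<Rightarrow> bool" where
  "arrow_obeys K a \<longleftrightarrow> (\<forall>i\<in>{1..arrow_size a}.
     K (box_of (snd (source a)) (snd (target a)) (rl (snd (source a)) (snd (target a))) i)
       (box_of (fst (target a)) (fst (source a)) (tableau a) i))"

abbreviation upper_box :: "nat \<Rightarrow> box \<Rightarrow> box \<Rightarrow> bool" where
  "upper_box r b c \<equiv> row_rule_filling r b \<le> int (fst c)"

lemma row_rule_iff: "row_rule r a \<longleftrightarrow> arrow_obeys (upper_box r) a"
  by (simp add: row_rule_def arrow_obeys_def arrow_R_def arrow_row_def Let_def)

lemma reverse_row_rule_iff:
  "reverse_row_rule r a \<longleftrightarrow> arrow_obeys (\<lambda>b c. \<not> upper_box r b c) a"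
  by (simp add: reverse_row_rule_def arrow_obeys_def arrow_R_def arrow_row_def Let_def not_le)

lemma ball_labels_iff:
  "(\<forall>i\<in>{1..card (skew \<alpha> \<beta>)}. K (box_of \<alpha> \<beta> (rl \<alpha> \<beta>) i) (box_of \<gamma> \<delta> T i)) \<longleftrightarrow>
   (\<forall>b\<in>skew \<alpha> \<beta>. K b (RW_to_picture \<gamma> \<delta> \<alpha> \<beta> T b))"
proof -
  have N: "{1..card (skew \<alpha> \<beta>)} = rl \<alpha> \<beta> ` skew \<alpha> \<beta>" using bij_rl by (metis bij_betw_def)
  have box_rl: "box_of \<alpha> \<beta> (rl \<alpha> \<beta>) (rl \<alpha> \<beta> b) = b" if "b \<in> skew \<alpha> \<beta>" for b
    unfolding box_of_def using that bij_rl[of \<alpha> \<beta>] by (simp add: bij_betw_def)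
  show ?thesis unfolding N ball_simps
    by (intro ball_cong refl) (simp only: box_rl RW_to_picture_def restrict_apply')
qed

lemma extensional_empty: "f \<in> extensional {} \<longleftrightarrow> f = (\<lambda>_. undefined)"
  by (simp add: extensional_def fun_eq_iff)

lemma picture_empty: "picture {} {} f \<longleftrightarrow> f = (\<lambda>_. undefined)"
  by (simp add: picture_def extensional_empty picture_local_def picture_order_def bij_betw_def)

text \<open>Both skew shapes are empty when the target is \<open>v\<close>, and the only extensional
  map on the empty set is constantly \<open>undefined\<close>.\<close>

lemma trivial_picture_from:
  "v \<in> quiver_vertices \<Longrightarrow> (v, f) \<in> pictures_from K v \<longleftrightarrow> f = (\<lambda>_. undefined)"
  by (simp add: pictures_from_def skew_def picture_empty)

text \<open>Target by target this is \<open>bij_betw_RW_pictures\<close>. The trivial picture is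
  removed because an arrow joins distinct vertices.\<close>

lemma bij_betw_arrows_pictures:
  assumes v: "v \<in> quiver_vertices"
  shows "bij_betw
    (\<lambda>a. (target a, RW_to_picture (fst (target a)) (fst v) (snd v) (snd (target a)) (tableau a)))
    {a \<in> arrows_from v. arrow_obeys K a} (pictures_from K v - {(v, \<lambda>_. undefined)})"
    (is "bij_betw ?\<Phi> ?X ?Y")
proof (rule bij_betw_imageI)
  have arrow: "a = Arrow v (target a) (tableau a) \<and> target a \<in> quiver_vertices \<and> target a \<noteq> v
      \<and> diagram (fst v) \<subseteq> diagram (fst (target a)) \<and> diagram (snd (target a)) \<subseteq> diagram (snd v)
      \<and> tableau a \<in> RW (fst (target a)) (fst v) (snd v) (snd (target a))"
    if "a \<in> arrows_from v" for a
    using that by (rule arrows_from_E) (auto simp: quiver_vertices_def)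
  show "inj_on ?\<Phi> ?X"
  proof (rule inj_onI)
    fix a b assume "a \<in> ?X" "b \<in> ?X" and eq: "?\<Phi> a = ?\<Phi> b"
    then have a: "a \<in> arrows_from v" and b: "b \<in> arrows_from v" by auto
    have t: "target a = target b" using eq by simp
    then have "tableau a = tableau b"
      using eq arrow[OF a] arrow[OF b] inj_onD[OF bij_betw_imp_inj_on[OF bij_betw_RW_pictures]]
      by simp
    with t show "a = b" using arrow[OF a] arrow[OF b] by metis
  qed
  have obeys: "arrow_obeys K (Arrow v u T) \<longleftrightarrow>
      (\<forall>b\<in>skew (snd v) (snd u). K b (RW_to_picture (fst u) (fst v) (snd v) (snd u) T b))"
    if "diagram (fst v) \<subseteq> diagram (fst u)" "T \<in> RW (fst u) (fst v) (snd v) (snd u)" for u T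
  proof -
    \<comment> \<open>\<open>arrow_size\<close> is computed from the first partitions; the equality
      of box counts demanded by \<open>RW\<close> makes it the number of labels in the skew shape of
      the second ones.\<close>
    have "arrow_size (Arrow v u T) = card (skew (snd v) (snd u))"
      using card_skew[OF that(1)] card_skew_RW[OF that(2)] by (simp add: arrow_size_def)
    then show ?thesis by (simp only: arrow_obeys_def arrow.sel ball_labels_iff)
  qed
  show "?\<Phi> ` ?X = ?Y"
  proof (intro equalityI subsetI)
    fix p assume "p \<in> ?\<Phi> ` ?X"
    then obtain a where a: "a \<in> arrows_from v" "arrow_obeys K a" and p: "p = ?\<Phi> a" by blast
    note A = arrow[OF a(1)]
    then have "arrow_obeys K (Arrow v (target a) (tableau a))" using a(2) by simp
    moreover have "picture (skew (snd v) (snd (target a))) (skew (fst (target a)) (fst v)) (snd p)"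
      using A picture_RW_to_picture by (simp add: p)
    ultimately show "p \<in> ?Y"
      using A obeys[of "target a" "tableau a"] by (auto simp: p pictures_from_def)
  next
    fix p assume p: "p \<in> ?Y"
    obtain u f where uf: "p = (u, f)" by (cases p)
    have P: "u \<in> quiver_vertices" "diagram (fst v) \<subseteq> diagram (fst u)"
      "diagram (snd u) \<subseteq> diagram (snd v)"
      "picture (skew (snd v) (snd u)) (skew (fst u) (fst v)) f"
      "\<And>b. b \<in> skew (snd v) (snd u) \<Longrightarrow> K b (f b)"
      using p by (auto simp: uf pictures_from_def)
    have "u \<noteq> v" using p trivial_picture_from[OF v] by (auto simp: uf)
    have "f \<in> RW_to_picture (fst u) (fst v) (snd v) (snd u) ` RW (fst u) (fst v) (snd v) (snd u)"
      using P(4) bij_betw_imp_surj_on[OF bij_betw_RW_pictures] by simp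
    then obtain T where T: "T \<in> RW (fst u) (fst v) (snd v) (snd u)"
      "f = RW_to_picture (fst u) (fst v) (snd v) (snd u) T" by blast
    have "Arrow v u T \<in> arrows_from v"
      using P v T \<open>u \<noteq> v\<close> unfolding arrows_from_def quiver_arrows_def
      by (cases v; cases u) auto
    moreover have "arrow_obeys K (Arrow v u T)" using obeys[OF P(2) T(1)] P(5) T(2) by simp
    ultimately show "p \<in> ?\<Phi> ` ?X"
      by (intro image_eqI[of _ _ "Arrow v u T"]) (auto simp: uf T(2))
  qed
qed

lemma finite_pictures_from:
  assumes "v \<in> quiver_vertices"
  shows "finite (pictures_from K v)"
  using bij_betw_finite[OF bij_betw_arrows_pictures[OF assms, of K]] finite_arrows_from by simp

text \<open>The trivial picture contributes \<open>g v\<close> and all others are arrows. The sum is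
  thus an identity plus an arrow counting matrix, applied to \<open>g\<close>.\<close>

lemma sum_pictures_from:
  fixes g :: "vertex \<Rightarrow> 'a::comm_monoid_add"
  assumes v: "v \<in> quiver_vertices"
  shows "(\<Sum>p\<in>pictures_from K v. g (fst p)) =
    g v + (\<Sum>a\<in>{a \<in> arrows_from v. arrow_obeys K a}. g (target a))"
proof -
  have "(\<Sum>p\<in>pictures_from K v. g (fst p)) =
      g v + (\<Sum>p\<in>pictures_from K v - {(v, \<lambda>_. undefined)}. g (fst p))"
    using v by (subst sum.remove[of _ "(v, \<lambda>_. undefined)"])
      (auto simp: finite_pictures_from trivial_picture_from)
  also have "(\<Sum>p\<in>pictures_from K v - {(v, \<lambda>_. undefined)}. g (fst p)) =
      (\<Sum>a\<in>{a \<in> arrows_from v. arrow_obeys K a}. g (target a))"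
    by (subst sum.reindex_bij_betw[OF bij_betw_arrows_pictures[OF v], symmetric]) simp
  finally show ?thesis .
qed

section \<open>Partitions from order ideals of boxes\<close>

lemma diagram_pos: "b \<in> diagram \<alpha> \<Longrightarrow> 1 \<le> fst b \<and> 1 \<le> snd b"
  by (auto simp: diagram_def)

lemma diagram_down:
  assumes "is_partition \<alpha>" "c \<in> diagram \<alpha>" "1 \<le> fst b" "1 \<le> snd b" "fst b \<le> fst c" "snd b \<le> snd c"
  shows "b \<in> diagram \<alpha>"
proof -
  obtain i j k l where b: "b = (i, j)" and c: "c = (k, l)" by (cases b, cases c)
  have "\<alpha> ! (i - 1) \<ge> \<alpha> ! (k - 1)"
  proof (cases "i = k")
    case False
    then show ?thesis using assms sorted_wrt_nth_less[of "(\<ge>)" \<alpha> "i - 1" "k - 1"]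
      by (auto simp: b c is_partition_def diagram_def)
  qed simp
  then show ?thesis using assms by (auto simp: b c diagram_def)
qed

text \<open>A member \<open>x\<close> brings all of \<open>{1..x}\<close> with it, while a missing
  positive \<open>x\<close> confines the set below \<open>x\<close>. This reads row lengths and
  column heights off cardinalities.\<close>

lemma mem_initial_segment_iff:
  fixes S :: "nat set"
  assumes fin: "finite S" and nz: "0 \<notin> S"
    and down: "\<And>x y. y \<in> S \<Longrightarrow> 1 \<le> x \<Longrightarrow> x \<le> y \<Longrightarrow> x \<in> S"
  shows "x \<in> S \<longleftrightarrow> 1 \<le> x \<and> x \<le> card S"
proof
  assume x: "x \<in> S"
  then have "{1..x} \<subseteq> S" using down by (meson atLeastAtMost_iff subsetI)
  from card_mono[OF fin this] have "x \<le> card S" by simp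
  moreover have "x \<noteq> 0" using x nz by (intro notI) simp
  ultimately show "1 \<le> x \<and> x \<le> card S" by simp
next
  assume x: "1 \<le> x \<and> x \<le> card S"
  show "x \<in> S"
  proof (rule ccontr)
    assume "x \<notin> S"
    have "S \<subseteq> {1..<x}"
    proof
      fix y assume y: "y \<in> S"
      have "\<not> x \<le> y" using down[OF y, of x] x \<open>x \<notin> S\<close> by blast
      moreover have "y \<noteq> 0" using y nz by (intro notI) simp
      ultimately show "y \<in> {1..<x}" by simp
    qed
    from card_mono[OF _ this] have "card S \<le> x - 1" by simp
    then show False using x by linarith
  qed
qed

text \<open>The parts are the row sizes of \<open>D\<close>, and their number is the height of its
  first column. This provides the intermediate vertex when a picture is factored.\<close>

lemma partition_of_order_ideal:
  assumes fin: "finite D" and pos: "\<And>i j. (i, j) \<in> D \<Longrightarrow> 1 \<le> i \<and> 1 \<le> j"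
    and up: "\<And>i j. 1 \<le> i \<Longrightarrow> (Suc i, j) \<in> D \<Longrightarrow> (i, j) \<in> D"
    and left: "\<And>i j. 1 \<le> j \<Longrightarrow> (i, Suc j) \<in> D \<Longrightarrow> (i, j) \<in> D"
  obtains \<beta> where "is_partition \<beta>" "diagram \<beta> = D"
proof -
  have left': "(i, j) \<in> D" if "1 \<le> j" "j \<le> k" "(i, k) \<in> D" for i j k
    using that(2,3)
  proof (induction rule: dec_induct)
    case (step n)
    have "1 \<le> n" using that(1) step.hyps by simp
    then show ?case using left[OF _ step.prems] step.IH by simp
  qed
  have up': "(i, j) \<in> D" if "1 \<le> i" "i \<le> k" "(k, j) \<in> D" for i j k
    using that(2,3)
  proof (induction rule: dec_induct)
    case (step n)
    have "1 \<le> n" using that(1) step.hyps by simp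
    then show ?case using up[OF _ step.prems] step.IH by simp
  qed
  define len where "len i = card {j. (i, j) \<in> D}" for i
  define h where "h = card {i. (i, 1) \<in> D}"
  have row: "(i, j) \<in> D \<longleftrightarrow> 1 \<le> j \<and> j \<le> len i" for i j
  proof -
    have "finite {j. (i, j) \<in> D}"
      by (rule finite_subset[OF _ finite_imageI[OF fin, of snd]])
        (auto intro: rev_image_eqI)
    moreover have "0 \<notin> {j. (i, j) \<in> D}" using pos by auto
    ultimately have "j \<in> {j. (i, j) \<in> D} \<longleftrightarrow> 1 \<le> j \<and> j \<le> card {j. (i, j) \<in> D}"
      by (rule mem_initial_segment_iff) (metis left' mem_Collect_eq)
    then show ?thesis by (simp add: len_def)
  qed
  have height: "(i, 1) \<in> D \<longleftrightarrow> 1 \<le> i \<and> i \<le> h" for i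
  proof -
    have "finite {i. (i, 1) \<in> D}"
      by (rule finite_subset[OF _ finite_imageI[OF fin, of fst]])
        (auto intro: rev_image_eqI)
    moreover have "0 \<notin> {i. (i, 1) \<in> D}" using pos by auto
    ultimately have "i \<in> {i. (i, 1) \<in> D} \<longleftrightarrow> 1 \<le> i \<and> i \<le> card {i. (i, 1) \<in> D}"
      by (rule mem_initial_segment_iff) (metis up' mem_Collect_eq)
    then show ?thesis by (simp add: h_def)
  qed
  define \<beta> where "\<beta> = map (\<lambda>i. len (Suc i)) [0..<h]"
  have "len (Suc k) \<le> len (Suc i)" if "i < k" for i k
  proof (rule ccontr)
    assume *: "\<not> len (Suc k) \<le> len (Suc i)"
    then have "(Suc k, len (Suc k)) \<in> D" unfolding row by simp
    then have "(Suc i, len (Suc k)) \<in> D" using up'[of "Suc i" "Suc k"] that by simp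
    then show False using * unfolding row by simp
  qed
  then have "sorted_wrt (\<ge>) \<beta>" by (auto simp: \<beta>_def sorted_wrt_iff_nth_less)
  moreover have "len (Suc i) \<noteq> 0" if "i < h" for i
    using height[of "Suc i"] row[of "Suc i" 1] that by simp
  then have "0 \<notin> set \<beta>" by (fastforce simp: \<beta>_def)
  ultimately have "is_partition \<beta>" by (simp add: is_partition_def)
  moreover have "diagram \<beta> = D"
  proof -
    have "(i, j) \<in> diagram \<beta> \<longleftrightarrow> (i, j) \<in> D" for i j
    proof -
      have "(i, j) \<in> diagram \<beta> \<longleftrightarrow> (1 \<le> i \<and> i \<le> h) \<and> 1 \<le> j \<and> j \<le> len i"
        by (auto simp: diagram_def \<beta>_def)
      also have "\<dots> \<longleftrightarrow> (i, 1) \<in> D \<and> (i, j) \<in> D" by (simp only: flip: height row)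
      also have "\<dots> \<longleftrightarrow> (i, j) \<in> D" using left'[of 1 j i] pos by blast
      finally show ?thesis .
    qed
    then show ?thesis by auto
  qed
  ultimately show ?thesis by (rule that)
qed

section \<open>Monotonicity of pictures on skew shapes\<close>

lemma skew_convex:
  assumes "is_partition \<alpha>" "is_partition \<beta>" "(i, j) \<in> skew \<alpha> \<beta>" "(k, l) \<in> skew \<alpha> \<beta>"
    "i \<le> m" "m \<le> k" "j \<le> n" "n \<le> l"
  shows "(m, n) \<in> skew \<alpha> \<beta>"
proof -
  have mem: "(i, j) \<in> diagram \<alpha>" "(k, l) \<in> diagram \<alpha>" "(i, j) \<notin> diagram \<beta>"
    using assms(3,4) by (simp_all add: skew_def)
  have ij: "1 \<le> i" "1 \<le> j" using diagram_pos[OF mem(1)] by simp_all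
  have "(m, n) \<in> diagram \<alpha>"
    by (rule diagram_down[OF assms(1) mem(2)]) (use assms(5-8) ij in simp_all)
  moreover have "(m, n) \<notin> diagram \<beta>"
  proof
    assume "(m, n) \<in> diagram \<beta>"
    then have "(i, j) \<in> diagram \<beta>"
      by (rule diagram_down[OF assms(2)]) (use assms(5-8) ij in simp_all)
    with mem(3) show False ..
  qed
  ultimately show ?thesis by (simp add: skew_def)
qed

text \<open>Walk from \<open>b\<close> down its column to the row of \<open>c\<close>, then right to
  \<open>c\<close>; convexity keeps the path inside the shape. Each step down raises the image row
  by at least one and does not raise the image column; each step right lowers the image column by at
  least one and does not lower the image row.\<close>

lemma picture_local_mono:
  assumes part: "is_partition \<alpha>" "is_partition \<beta>" and f: "picture_local (skew \<alpha> \<beta>) f"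
    and b: "b \<in> skew \<alpha> \<beta>" and c: "c \<in> skew \<alpha> \<beta>" and le: "fst b \<le> fst c" "snd b \<le> snd c"
  shows "fst (f b) + fst c \<le> fst (f c) + fst b \<and> snd (f c) + snd c \<le> snd (f b) + snd b"
proof -
  obtain i j k l where bc: "b = (i, j)" "c = (k, l)" by (cases b, cases c)
  have ij: "(i, j) \<in> skew \<alpha> \<beta>" and kl: "(k, l) \<in> skew \<alpha> \<beta>" using b c bc by simp_all
  have corner: "(k, j) \<in> skew \<alpha> \<beta>"
    by (rule skew_convex[OF part ij kl]) (use le bc in simp_all)
  have "k \<ge> i" using le bc by simp
  then have col: "fst (f (i, j)) + k \<le> fst (f (k, j)) + i \<and> snd (f (k, j)) \<le> snd (f (i, j))"
    using corner
  proof (induction rule: dec_induct)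
    case (step n)
    have n: "(n, j) \<in> skew \<alpha> \<beta>"
      by (rule skew_convex[OF part ij step.prems]) (use step.hyps in simp_all)
    have "fst (f (n, j)) < fst (f (Suc n, j)) \<and> snd (f (Suc n, j)) \<le> snd (f (n, j))"
      using f n step.prems by (simp add: picture_local_def)
    with step.IH[OF n] show ?case by simp
  qed simp
  have "l \<ge> j" using le bc by simp
  then have "fst (f (k, j)) \<le> fst (f (k, l)) \<and> snd (f (k, l)) + l \<le> snd (f (k, j)) + j"
    using kl
  proof (induction rule: dec_induct)
    case (step n)
    have n: "(k, n) \<in> skew \<alpha> \<beta>"
      by (rule skew_convex[OF part corner step.prems]) (use step.hyps in simp_all)
    have "snd (f (k, Suc n)) < snd (f (k, n)) \<and> fst (f (k, n)) \<le> fst (f (k, Suc n))"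
      using f n step.prems by (simp add: picture_local_def)
    with step.IH[OF n] show ?case by simp
  qed simp
  with col show ?thesis by (simp add: bc)
qed

text \<open>Here \<open>b\<close> is read before \<open>c\<close>, and \<open>b\<close> cannot be
  strictly above and strictly left of \<open>c\<close>, since then \<open>f c\<close> would be
  strictly below and strictly left of \<open>f b\<close>. In every remaining position row minus
  column is smaller at \<open>b\<close>.\<close>

lemma picture_filling_less:
  assumes part: "is_partition \<alpha>" "is_partition \<beta>" and f: "picture (skew \<alpha> \<beta>) B f"
    and b: "b \<in> skew \<alpha> \<beta>" and c: "c \<in> skew \<alpha> \<beta>"
    and lt: "fst (f b) = fst (f c) \<and> snd (f b) < snd (f c) \<or>
      snd (f b) = snd (f c) \<and> fst (f b) < fst (f c)"
  shows "row_rule_filling r b < row_rule_filling r c"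
proof -
  have "reads_before b c" using f b c lt by (auto simp: picture_def picture_order_def)
  moreover have "\<not> (fst b < fst c \<and> snd b < snd c)"
    using picture_local_mono[OF part _ b c, of f] f lt by (auto simp: picture_def)
  ultimately show ?thesis by (auto simp: reads_before_def row_rule_filling_def)
qed

lemma picture_restrict:
  assumes "picture A B f" "C \<subseteq> A"
  shows "picture C (f ` C) (restrict f C)"
proof -
  have "inj_on f C" using assms by (auto simp: picture_def bij_betw_def intro: inj_on_subset)
  then have "bij_betw (restrict f C) C (f ` C)" by (simp add: bij_betw_def inj_on_def)
  moreover have "picture_local C (restrict f C)"
    using assms unfolding picture_def picture_local_def by (simp add: subset_iff)
  moreover have "picture_order C (restrict f C)"
    using assms unfolding picture_def picture_order_def by (simp add: subset_iff Ball_def)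
  ultimately show ?thesis by (simp add: picture_def)
qed

section \<open>Gluing and factoring pictures\<close>

text \<open>Outside both skew shapes the value comes from \<open>g\<close>, hence is
  \<open>undefined\<close> when \<open>g\<close> is extensional, so the glued map is extensional on
  the union.\<close>

definition glue :: "vertex \<Rightarrow> vertex \<Rightarrow> (box \<Rightarrow> box) \<Rightarrow> (box \<Rightarrow> box) \<Rightarrow> box \<Rightarrow> box" where
  "glue v u f g = (\<lambda>b. if b \<in> skew (snd v) (snd u) then f b else g b)"

abbreviation row_pictures :: "nat \<Rightarrow> vertex \<Rightarrow> (vertex \<times> (box \<Rightarrow> box)) set" where
  "row_pictures r \<equiv> pictures_from (upper_box r)"

abbreviation reverse_row_pictures :: "nat \<Rightarrow> vertex \<Rightarrow> (vertex \<times> (box \<Rightarrow> box)) set" where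
  "reverse_row_pictures r \<equiv> pictures_from (\<lambda>b c. \<not> upper_box r b c)"

abbreviation all_pictures :: "vertex \<Rightarrow> (vertex \<times> (box \<Rightarrow> box)) set" where
  "all_pictures \<equiv> pictures_from (\<lambda>b c. True)"

lemma skew_Un:
  assumes "diagram \<beta> \<subseteq> diagram \<alpha>" "diagram \<gamma> \<subseteq> diagram \<beta>"
  shows "skew \<alpha> \<beta> \<union> skew \<beta> \<gamma> = skew \<alpha> \<gamma>" "skew \<alpha> \<beta> \<inter> skew \<beta> \<gamma> = {}"
  using assms by (auto simp: skew_def)

lemma row_rule_filling_simps [simp]:
  "row_rule_filling r (Suc i, j) = row_rule_filling r (i, j) + 1"
  "row_rule_filling r (i, Suc j) = row_rule_filling r (i, j) - 1"
  by (simp_all add: row_rule_filling_def)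

text \<open>Pairs of boxes inside one piece inherit all conditions. For mixed pairs, the
  intermediate vertex gives the relative position of the pieces, and the two opposite inequalities
  between filling and image row give the rest.\<close>

lemma glue_in_all_pictures:
  assumes v: "v \<in> quiver_vertices"
    and uf: "(u, f) \<in> row_pictures r v" and xg: "(x, g) \<in> reverse_row_pictures r u"
  shows "(x, glue v u f g) \<in> all_pictures v"
proof -
  obtain v1 v2 u1 u2 x1 x2 where vs: "v = (v1, v2)" "u = (u1, u2)" "x = (x1, x2)"
    by (cases v, cases u, cases x)
  have part: "is_partition v1" "is_partition v2" "is_partition u1" "is_partition u2"
    "is_partition x1" "is_partition x2"
    using v uf xg by (auto simp: vs pictures_from_def quiver_vertices_def)
  have sub: "diagram v1 \<subseteq> diagram u1" "diagram u1 \<subseteq> diagram x1"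
    "diagram u2 \<subseteq> diagram v2" "diagram x2 \<subseteq> diagram u2"
    using uf xg by (auto simp: vs pictures_from_def)
  let ?A = "skew v2 u2" and ?B = "skew u2 x2"
  define h where "h = glue v u f g"
  have hA: "h b = f b" if "b \<in> ?A" for b using that by (simp add: h_def glue_def vs)
  have hB: "h b = g b" if "b \<in> ?B" for b using that by (simp add: h_def glue_def vs skew_def)
  have f: "picture ?A (skew u1 v1) f" "\<And>b. b \<in> ?A \<Longrightarrow> upper_box r b (h b)"
    using uf hA by (auto simp: vs pictures_from_def)
  have g: "picture ?B (skew x1 u1) g" "\<And>b. b \<in> ?B \<Longrightarrow> \<not> upper_box r b (h b)"
    using xg hB by (auto simp: vs pictures_from_def)
  have AB: "?A \<union> ?B = skew v2 x2" "?A \<inter> ?B = {}" using skew_Un sub by auto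
  have split: "b \<in> ?A \<or> b \<in> ?B" if "b \<in> skew v2 x2" for b using that AB by blast
  have himA: "h b \<in> diagram u1" if "b \<in> ?A" for b
    using bij_betwE[of f ?A "skew u1 v1"] f(1) that hA by (simp add: picture_def skew_def)
  have himB: "h b \<in> diagram x1" "h b \<notin> diagram u1" if "b \<in> ?B" for b
    using bij_betwE[of g ?B "skew x1 u1"] g(1) that hB by (simp_all add: picture_def skew_def)
  \<comment> \<open>Images of \<open>?A\<close> lie in the diagram of \<open>u1\<close>, which is
    closed under moves up and left, and images of \<open>?B\<close> lie outside it.\<close>
  have not_nw: "\<not> (fst (h b) \<le> fst (h c) \<and> snd (h b) \<le> snd (h c))"
    if "b \<in> ?B" "c \<in> ?A" for b c
    using diagram_down[OF part(3) himA[OF that(2)], of "h b"] himB[OF that(1)]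
      diagram_pos[OF himB(1)[OF that(1)]] by blast
  have down: "b \<in> ?B" if "b \<in> skew v2 x2" "c \<in> ?B" "fst b \<le> fst c" "snd b \<le> snd c" for b c
  proof -
    have b: "b \<in> diagram v2" "b \<notin> diagram x2" and c: "c \<in> diagram u2"
      using that by (simp_all add: skew_def)
    have "b \<in> diagram u2"
      by (rule diagram_down[OF part(4) c]) (use diagram_pos[OF b(1)] that in simp_all)
    then show ?thesis using b by (simp add: skew_def)
  qed
  have bij: "bij_betw h (skew v2 x2) (skew x1 v1)"
  proof -
    have "bij_betw h ?A (skew u1 v1)"
      using f(1) hA by (simp add: picture_def cong: bij_betw_cong)
    moreover have "bij_betw h ?B (skew x1 u1)"
      using g(1) hB by (simp add: picture_def cong: bij_betw_cong)
    ultimately have "bij_betw h (?A \<union> ?B) (skew u1 v1 \<union> skew x1 u1)"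
      by (rule bij_betw_combine) (auto simp: skew_def)
    moreover have "skew u1 v1 \<union> skew x1 u1 = skew x1 v1" using sub by (auto simp: skew_def)
    ultimately show ?thesis by (simp add: AB)
  qed
  have loc: "picture_local (skew v2 x2) h"
    unfolding picture_local_def
  proof (intro conjI allI impI)
    fix i j assume b: "(i, j) \<in> skew v2 x2" and c: "(i, Suc j) \<in> skew v2 x2"
    have "snd (h (i, Suc j)) < snd (h (i, j)) \<and> fst (h (i, j)) \<le> fst (h (i, Suc j))"
    proof (cases "(i, Suc j) \<in> ?B")
      case True
      then have "(i, j) \<in> ?B" using down[OF b] by simp
      then show ?thesis using True g(1) hB by (simp add: picture_def picture_local_def)
    next
      case False
      then have cA: "(i, Suc j) \<in> ?A" using split[OF c] by blast
      show ?thesis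
      proof (cases "(i, j) \<in> ?A")
        case True
        then show ?thesis using cA f(1) hA by (simp add: picture_def picture_local_def)
      next
        case False
        then have bB: "(i, j) \<in> ?B" using split[OF b] by blast
        \<comment> \<open>The filling drops by one to the right, so the image row at the left box is
          below its filling value, which is at most one more than the image row at the right box.
          Then \<open>not_nw\<close> forces the column inequality.\<close>
        have "fst (h (i, j)) \<le> fst (h (i, Suc j))" using f(2)[OF cA] g(2)[OF bB] by simp
        then show ?thesis using not_nw[OF bB cA] by simp
      qed
    qed
    then show "snd (h (i, Suc j)) < snd (h (i, j))" "fst (h (i, j)) \<le> fst (h (i, Suc j))"
      by auto
  next
    fix i j assume b: "(i, j) \<in> skew v2 x2" and c: "(Suc i, j) \<in> skew v2 x2"
    have "fst (h (i, j)) < fst (h (Suc i, j)) \<and> snd (h (Suc i, j)) \<le> snd (h (i, j))"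
    proof (cases "(Suc i, j) \<in> ?B")
      case True
      then have "(i, j) \<in> ?B" using down[OF b] by simp
      then show ?thesis using True g(1) hB by (simp add: picture_def picture_local_def)
    next
      case False
      then have cA: "(Suc i, j) \<in> ?A" using split[OF c] by blast
      show ?thesis
      proof (cases "(i, j) \<in> ?A")
        case True
        then show ?thesis using cA f(1) hA by (simp add: picture_def picture_local_def)
      next
        case False
        then have bB: "(i, j) \<in> ?B" using split[OF b] by blast
        \<comment> \<open>Downwards the filling rises by one, so the same comparison is
          strict.\<close>
        have "fst (h (i, j)) < fst (h (Suc i, j))" using f(2)[OF cA] g(2)[OF bB] by simp
        then show ?thesis using not_nw[OF bB cA] by simp
      qed
    qed
    then show "fst (h (i, j)) < fst (h (Suc i, j))" "snd (h (Suc i, j)) \<le> snd (h (i, j))"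
      by auto
  qed
  have ord: "picture_order (skew v2 x2) h"
    unfolding picture_order_def
  proof (intro ballI impI)
    fix b c assume b: "b \<in> skew v2 x2" and c: "c \<in> skew v2 x2"
      and lt: "fst (h b) = fst (h c) \<and> snd (h b) < snd (h c) \<or>
        snd (h b) = snd (h c) \<and> fst (h b) < fst (h c)"
    consider "b \<in> ?A" "c \<in> ?A" | "b \<in> ?B" "c \<in> ?B" | "b \<in> ?A" "c \<in> ?B" | "b \<in> ?B" "c \<in> ?A"
      using split b c by blast
    then show "reads_before b c"
    proof cases
      case 1
      then show ?thesis using lt picture_orderD[of ?A f b c] f(1) by (simp add: hA picture_def)
    next
      case 2
      then show ?thesis using lt picture_orderD[of ?B g b c] g(1) by (simp add: hB picture_def)
    next
      case 3
      show ?thesis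
      proof (rule ccontr)
        assume "\<not> reads_before b c"
        then have "reads_before c b" using reads_before_linear[of b c] 3 AB(2) by blast
        then consider "fst c = fst b" "snd b < snd c" | "fst c < fst b"
          by (auto simp: reads_before_def)
        then show False
        proof cases
          case 1
          then have "b \<in> ?B" using down[OF b 3(2)] by simp
          then show False using 3 AB(2) by blast
        next
          case 2
          \<comment> \<open>By \<open>lt\<close> the image row of \<open>b\<close> is at most that
            of \<open>c\<close>, so the inequalities for \<open>?A\<close> and \<open>?B\<close>
            chain. Hence \<open>c\<close> lies above and weakly left of \<open>b\<close>, and
            monotonicity puts \<open>h b\<close> strictly below \<open>h c\<close>, against
            \<open>lt\<close>.\<close>
          have "row_rule_filling r b < row_rule_filling r c"
            using f(2)[OF 3(1)] g(2)[OF 3(2)] lt by auto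
          then have "snd c \<le> snd b" using 2 by (simp add: row_rule_filling_def)
          then show False
            using picture_local_mono[OF part(2,6) loc c b] 2 lt by auto
        qed
      qed
    next
      \<comment> \<open>This case is void: \<open>lt\<close> would place \<open>h b\<close> weakly
        above and left of \<open>h c\<close>.\<close>
      case 4
      then show ?thesis using not_nw[OF 4] lt by auto
    qed
  qed
  have "h \<in> extensional (skew v2 x2)"
    using AB g(1) by (auto simp: h_def glue_def vs picture_def extensional_def)
  then have "picture (skew v2 x2) (skew x1 v1) h" using bij loc ord by (simp add: picture_def)
  then show ?thesis using xg sub unfolding h_def by (auto simp: vs pictures_from_def)
qed

text \<open>Every box of the first piece passes the test \<open>upper_box\<close> and every box of
  the second fails it, so the glued map alone reveals where it was cut. This gives injectivity of
  gluing.\<close>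

lemma glue_determines_factors:
  assumes v: "v \<in> quiver_vertices"
    and uf: "(u, f) \<in> row_pictures r v" and xg: "(x, g) \<in> reverse_row_pictures r u"
  defines "h \<equiv> glue v u f g"
  defines "A \<equiv> {b \<in> skew (snd v) (snd x). upper_box r b (h b)}"
  shows "diagram (snd u) = diagram (snd v) - A" "diagram (fst u) = diagram (fst v) \<union> h ` A"
    "f = restrict h A" "g = restrict h (skew (snd v) (snd x) - A)"
proof -
  have sub: "diagram (fst v) \<subseteq> diagram (fst u)" "diagram (fst u) \<subseteq> diagram (fst x)"
    "diagram (snd u) \<subseteq> diagram (snd v)" "diagram (snd x) \<subseteq> diagram (snd u)"
    using uf xg by (auto simp: pictures_from_def)
  let ?A = "skew (snd v) (snd u)" and ?B = "skew (snd u) (snd x)"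
  have AB: "?A \<union> ?B = skew (snd v) (snd x)" "?A \<inter> ?B = {}" using skew_Un[OF sub(3,4)] by auto
  have hA: "h b = f b" if "b \<in> ?A" for b using that by (simp add: h_def glue_def)
  have hB: "h b = g b" if "b \<in> ?B" for b using that by (simp add: h_def glue_def skew_def)
  have f: "picture ?A (skew (fst u) (fst v)) f" "\<And>b. b \<in> ?A \<Longrightarrow> upper_box r b (h b)"
    using uf hA by (auto simp: pictures_from_def)
  have g: "picture ?B (skew (fst x) (fst u)) g" "\<And>b. b \<in> ?B \<Longrightarrow> \<not> upper_box r b (h b)"
    using xg hB by (auto simp: pictures_from_def)
  have A: "A = ?A" using f(2) g(2) AB unfolding A_def by blast
  have B: "skew (snd v) (snd x) - A = ?B" using AB A by blast
  show "diagram (snd u) = diagram (snd v) - A" using sub by (auto simp: A skew_def)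
  have "h ` A = skew (fst u) (fst v)" using f(1) hA by (simp add: A picture_def bij_betw_def)
  then show "diagram (fst u) = diagram (fst v) \<union> h ` A" using sub by (auto simp: skew_def)
  show "f = restrict h A"
    using f(1) by (auto simp: A picture_def hA intro!: extensionalityI[of _ ?A])
  show "g = restrict h (skew (snd v) (snd x) - A)"
    unfolding B using g(1) by (auto simp: picture_def hB intro!: extensionalityI[of _ ?B])
qed

text \<open>Cut \<open>h\<close> at the test \<open>upper_box\<close>. What needs proof is that the
  cut is made along partitions, both in the domain and in the image.\<close>

lemma all_pictures_factor:
  assumes v: "v \<in> quiver_vertices" and xh: "(x, h) \<in> all_pictures v"
  obtains u f g where "(u, f) \<in> row_pictures r v" "(x, g) \<in> reverse_row_pictures r u"
    "h = glue v u f g"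
proof -
  obtain v1 v2 x1 x2 where vs: "v = (v1, v2)" "x = (x1, x2)" by (cases v, cases x)
  have part: "is_partition v1" "is_partition v2" "is_partition x1" "is_partition x2"
    using v xh by (auto simp: vs pictures_from_def quiver_vertices_def)
  have sub: "diagram v1 \<subseteq> diagram x1" "diagram x2 \<subseteq> diagram v2"
    using xh by (auto simp: vs pictures_from_def)
  have h: "picture (skew v2 x2) (skew x1 v1) h" using xh by (simp add: vs pictures_from_def)
  then have loc: "picture_local (skew v2 x2) h" and img: "h ` skew v2 x2 = skew x1 v1"
    and inj: "inj_on h (skew v2 x2)"
    by (auto simp: picture_def bij_betw_def)
  define A where "A = {b \<in> skew v2 x2. upper_box r b (h b)}"
  define B where "B = skew v2 x2 - A"
  obtain u2 where u2: "is_partition u2" "diagram u2 = diagram x2 \<union> B"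
  proof (rule partition_of_order_ideal)
    show "finite (diagram x2 \<union> B)" by (simp add: B_def)
    show "1 \<le> i \<and> 1 \<le> j" if "(i, j) \<in> diagram x2 \<union> B" for i j
      using that diagram_pos[of "(i, j)"] by (auto simp: B_def skew_def)
    \<comment> \<open>Only moves inside the skew shape can fail to stay in the set; for them the
      assumption \<open>next_box\<close>, read backwards, says that the left or upper neighbour of a
      box that is not upper is not upper either.\<close>
    have step: "b \<in> diagram x2 \<union> B"
      if c: "c \<in> diagram x2 \<union> B" and pos: "1 \<le> fst b" "1 \<le> snd b"
        and le: "fst b \<le> fst c" "snd b \<le> snd c"
        and next_box: "b \<in> skew v2 x2 \<Longrightarrow> c \<in> skew v2 x2 \<Longrightarrow> upper_box r b (h b) \<Longrightarrow> upper_box r c (h c)"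
      for b c
    proof (cases "b \<in> diagram x2")
      case False
      then have "c \<in> B" using diagram_down[OF part(4) _ pos le] c by blast
      then have "c \<in> diagram v2" by (simp add: B_def skew_def)
      then have "b \<in> diagram v2" using diagram_down[OF part(2) _ pos le] by blast
      then show ?thesis using False next_box \<open>c \<in> B\<close> by (simp add: B_def A_def skew_def) blast
    qed simp
    show "(i, j) \<in> diagram x2 \<union> B" if "1 \<le> i" "(Suc i, j) \<in> diagram x2 \<union> B" for i j
    proof (rule step[OF that(2)])
      show "1 \<le> snd (i, j)" using that diagram_pos[of "(Suc i, j)"] by (auto simp: B_def skew_def)
      assume *: "(i, j) \<in> skew v2 x2" "(Suc i, j) \<in> skew v2 x2" "upper_box r (i, j) (h (i, j))"
      then have "fst (h (i, j)) < fst (h (Suc i, j))"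
        using loc unfolding picture_local_def by blast
      \<comment> \<open>The filling rises by exactly one and the image row by at least one.\<close>
      then show "upper_box r (Suc i, j) (h (Suc i, j))" using * by simp
    qed (use that in simp_all)
    show "(i, j) \<in> diagram x2 \<union> B" if "1 \<le> j" "(i, Suc j) \<in> diagram x2 \<union> B" for i j
    proof (rule step[OF that(2)])
      show "1 \<le> fst (i, j)" using that diagram_pos[of "(i, Suc j)"] by (auto simp: B_def skew_def)
      assume *: "(i, j) \<in> skew v2 x2" "(i, Suc j) \<in> skew v2 x2" "upper_box r (i, j) (h (i, j))"
      then have "fst (h (i, j)) \<le> fst (h (i, Suc j))"
        using loc unfolding picture_local_def by blast
      \<comment> \<open>The filling falls by one while the image row does not fall.\<close>
      then show "upper_box r (i, Suc j) (h (i, Suc j))" using * by simp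
    qed (use that in simp_all)
  qed
  obtain u1 where u1: "is_partition u1" "diagram u1 = diagram v1 \<union> h ` A"
  proof (rule partition_of_order_ideal)
    have hA: "h ` A \<subseteq> diagram x1" using img by (auto simp: A_def skew_def)
    show "finite (diagram v1 \<union> h ` A)" by (simp add: A_def)
    show pos1: "1 \<le> i \<and> 1 \<le> j" if "(i, j) \<in> diagram v1 \<union> h ` A" for i j
      using that hA diagram_pos[of "(i, j)"] by auto
    have step: "b \<in> diagram v1 \<union> h ` A"
      if c: "c \<in> diagram v1 \<union> h ` A" and pos: "1 \<le> fst b" "1 \<le> snd b"
        and adj: "fst c = fst b \<and> snd c = Suc (snd b) \<or> snd c = snd b \<and> fst c = Suc (fst b)"
      for b c
    proof (cases "b \<in> diagram v1")
      case False
      have le: "fst b \<le> fst c" "snd b \<le> snd c" using adj by auto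
      have "c \<in> h ` A" using False diagram_down[OF part(1) _ pos le] c by blast
      then obtain c' where c': "c' \<in> skew v2 x2" "c = h c'" "upper_box r c' c"
        by (auto simp: A_def)
      have "b \<in> diagram x1" using diagram_down[OF part(3) _ pos le] hA \<open>c \<in> h ` A\<close> by blast
      then have "b \<in> h ` skew v2 x2" using False unfolding img by (simp add: skew_def)
      then obtain b' where b': "b' \<in> skew v2 x2" "b = h b'" by blast
      have "row_rule_filling r b' < row_rule_filling r c'"
        using picture_filling_less[OF part(2,4) h b'(1) c'(1)] adj b'(2) c'(2) by auto
      \<comment> \<open>The filling at \<open>b'\<close> is at least one less than at
        \<open>c'\<close>, and the row of \<open>b\<close> is at most one less than the row of
        \<open>c\<close>.\<close>
      then have "upper_box r b' b" using c'(3) adj by auto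
      then show ?thesis using b' by (simp add: A_def)
    qed simp
    show "(i, j) \<in> diagram v1 \<union> h ` A" if "1 \<le> i" "(Suc i, j) \<in> diagram v1 \<union> h ` A" for i j
      using step[OF that(2), of "(i, j)"] that(1) pos1[OF that(2)] by simp
    show "(i, j) \<in> diagram v1 \<union> h ` A" if "1 \<le> j" "(i, Suc j) \<in> diagram v1 \<union> h ` A" for i j
      using step[OF that(2), of "(i, j)"] that(1) pos1[OF that(2)] by simp
  qed
  have sub_A: "A \<subseteq> skew v2 x2" "B \<subseteq> skew v2 x2" by (auto simp: A_def B_def)
  have A: "skew v2 u2 = A" using sub sub_A by (auto simp: skew_def u2 B_def)
  have B: "skew u2 x2 = B" using sub_A by (auto simp: skew_def u2)
  have hA: "h ` A = skew u1 v1" using img sub_A by (auto simp: skew_def u1)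
  have hB: "h ` B = skew x1 u1"
  proof -
    have "h ` B = h ` skew v2 x2 - h ` A" unfolding B_def
      using inj sub_A by (intro inj_on_image_set_diff) auto
    then show ?thesis using img by (auto simp: skew_def u1)
  qed
  have "h ` A \<subseteq> diagram x1" using img sub_A by (auto simp: skew_def)
  then have subs: "diagram v1 \<subseteq> diagram u1" "diagram u1 \<subseteq> diagram x1"
    "diagram u2 \<subseteq> diagram v2" "diagram x2 \<subseteq> diagram u2"
    using sub sub_A by (auto simp: u1 u2 skew_def)
  show ?thesis
  proof (rule that)
    show "((u1, u2), restrict h A) \<in> row_pictures r v"
      using picture_restrict[OF h sub_A(1)] subs part u1(1) u2(1)
      by (simp add: pictures_from_def vs quiver_vertices_def A hA) (simp add: A_def)
    show "(x, restrict h B) \<in> reverse_row_pictures r (u1, u2)"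
      using picture_restrict[OF h sub_A(2)] subs part u1(1) u2(1)
      by (simp add: pictures_from_def vs quiver_vertices_def B hB) (simp add: B_def A_def)
    have "h \<in> extensional (skew v2 x2)" using h by (simp add: picture_def)
    then show "h = glue v (u1, u2) (restrict h A) (restrict h B)"
      by (auto simp: fun_eq_iff glue_def vs A B_def extensional_def)
  qed
qed

text \<open>This is the matrix identity \<open>1 + A = (1 + B)(1 + C)\<close> in bijective form, the
  Sigma type being the product on the right.\<close>

lemma bij_betw_glue:
  assumes v: "v \<in> quiver_vertices"
  shows "bij_betw (\<lambda>((u, f), (x, g)). (x, glue v u f g))
    (SIGMA p:row_pictures r v. reverse_row_pictures r (fst p)) (all_pictures v)"
    (is "bij_betw ?\<Phi> ?X ?Y")
proof (rule bij_betw_imageI)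
  show "inj_on ?\<Phi> ?X"
  proof (rule inj_onI)
    fix p q assume p: "p \<in> ?X" and q: "q \<in> ?X" and eq: "?\<Phi> p = ?\<Phi> q"
    obtain u f x g where P: "p = ((u, f), (x, g))" by (metis surj_pair)
    obtain u' f' x' g' where Q: "q = ((u', f'), (x', g'))" by (metis surj_pair)
    have x: "x' = x" and h: "glue v u' f' g' = glue v u f g" using eq by (simp_all add: P Q)
    have "(u, f) \<in> row_pictures r v" "(x, g) \<in> reverse_row_pictures r u"
      using p by (auto simp: P)
    note U = glue_determines_factors[OF v this] and u = this(1)
    have "(u', f') \<in> row_pictures r v" "(x, g') \<in> reverse_row_pictures r u'"
      using q by (auto simp: Q x)
    note U' = glue_determines_factors[OF v this, unfolded h] and u' = this(1)
    \<comment> \<open>The cut determines the diagrams of the intermediate vertex, and a partition is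
      determined by its diagram.\<close>
    have "fst u = fst u'" "snd u = snd u'"
      using u u' U(1,2) U'(1,2)
      by (auto simp: pictures_from_def quiver_vertices_def intro!: diagram_inj)
    moreover have "f = f'" "g = g'" using U(3,4) U'(3,4) by simp_all
    ultimately show "p = q" by (simp add: P Q x prod_eq_iff)
  qed
  show "?\<Phi> ` ?X = ?Y"
  proof (intro equalityI subsetI)
    fix y assume "y \<in> ?\<Phi> ` ?X"
    then show "y \<in> ?Y" using glue_in_all_pictures[OF v] by auto
  next
    fix y assume "y \<in> ?Y"
    moreover obtain x h where y: "y = (x, h)" by (cases y)
    ultimately obtain u f g where "(u, f) \<in> row_pictures r v" "(x, g) \<in> reverse_row_pictures r u"
      "h = glue v u f g"
      using all_pictures_factor[OF v] by metis
    then show "y \<in> ?\<Phi> ` ?X" by (intro image_eqI[of _ _ "((u, f), (x, g))"]) (auto simp: y)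
  qed
qed

section \<open>Comparison of the two bases\<close>

lemma vertex_of_picture: "p \<in> pictures_from K v \<Longrightarrow> fst p \<in> quiver_vertices"
  by (auto simp: pictures_from_def)

text \<open>Induction on the size of the second partition: expand \<open>schur2 v\<close> in the
  \<open>w_basis\<close> over all pictures, group them by their first factor, and compare with the
  recursion for \<open>tau_basis\<close>.\<close>

lemma tau_basis_eq_sum_reverse_row_pictures:
  "v \<in> quiver_vertices \<Longrightarrow> tau_basis r v = (\<Sum>p\<in>reverse_row_pictures r v. w_basis (fst p))"
proof (induction "sum_list (snd v)" arbitrary: v rule: less_induct)
  case less
  note v = less.prems
  have all: "{a \<in> arrows_from v. arrow_obeys (\<lambda>b c. True) a} = arrows_from v"
    by (simp add: arrow_obeys_def)
  have "schur2 v = w_basis v + (\<Sum>a\<in>arrows_from v. w_basis (target a))"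
    by (simp add: w_basis.simps[of v])
  also have "\<dots> = (\<Sum>p\<in>all_pictures v. w_basis (fst p))"
    using sum_pictures_from[OF v, of w_basis "\<lambda>b c. True"] by (simp add: all)
  also have "\<dots> = (\<Sum>z\<in>(SIGMA p:row_pictures r v. reverse_row_pictures r (fst p)).
      w_basis (fst (snd z)))"
    by (subst sum.reindex_bij_betw[OF bij_betw_glue[OF v, of r], symmetric])
      (auto intro!: sum.cong)
  also have "\<dots> = (\<Sum>p\<in>row_pictures r v. \<Sum>q\<in>reverse_row_pictures r (fst p). w_basis (fst q))"
    by (subst sum.Sigma)
      (simp_all add: finite_pictures_from v vertex_of_picture split_def)
  \<comment> \<open>The trivial first factor yields the claimed sum; the others are arrows
    satisfying the row rule.\<close>
  also have "\<dots> = (\<Sum>q\<in>reverse_row_pictures r v. w_basis (fst q)) +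
      (\<Sum>a\<in>{a \<in> arrows_from v. row_rule r a}. \<Sum>q\<in>reverse_row_pictures r (target a). w_basis (fst q))"
    by (subst sum_pictures_from[OF v]) (simp add: row_rule_iff)
  also have "(\<Sum>a\<in>{a \<in> arrows_from v. row_rule r a}. \<Sum>q\<in>reverse_row_pictures r (target a). w_basis (fst q))
      = (\<Sum>a\<in>{a \<in> arrows_from v. row_rule r a}. tau_basis r (target a))"
  proof (rule sum.cong[OF refl])
    fix a assume "a \<in> {a \<in> arrows_from v. row_rule r a}"
    then have a: "a \<in> arrows_from v" by simp
    then have "target a \<in> quiver_vertices"
      by (rule arrows_from_E) (simp add: quiver_vertices_def)
    \<comment> \<open>Arrows shrink the second partition, so the induction hypothesis identifies the
      inner sum.\<close>
    then show "(\<Sum>q\<in>reverse_row_pictures r (target a). w_basis (fst q)) = tau_basis r (target a)"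
      using less.hyps[OF arrows_from_decreases[OF a]] by simp
  qed
  finally show ?case unfolding tau_basis.simps[of r v] by (simp only: add_diff_cancel_right')
qed

theorem mainTheorem7:
  fixes \<alpha>1 \<alpha>2 :: "nat list" and r :: nat
  assumes "is_partition \<alpha>1" and "is_partition \<alpha>2" and "r \<ge> 1"
  shows "tau_basis r (\<alpha>1, \<alpha>2) =
    w_basis (\<alpha>1, \<alpha>2)
    + (\<Sum>a\<in>{a \<in> arrows_from (\<alpha>1, \<alpha>2). reverse_row_rule r a}. w_basis (target a))"
proof -
  have v: "(\<alpha>1, \<alpha>2) \<in> quiver_vertices" using assms by (simp add: quiver_vertices_def)
  show ?thesis
    unfolding tau_basis_eq_sum_reverse_row_pictures[OF v] sum_pictures_from[OF v]
      reverse_row_rule_iff ..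
qed

end
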